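(* Let $m \geq 2$ be an integer and let $k = 2^m - 1$. Then there exists an intersecting $k$-family $\mathcal{F}$ in which every vertex has degree $3$ and whose length is $2k+1$. In particular, the transversal size of $\mathcal{F}$ is at least $(2k+1)/3$.
   Context: A $k$-set is a set with $k$ elements. A $k$-family is a collection of $k$-sets; its members are called blocks, and its length (or size) is the number of blocks in it. The set of vertices of a $k$-family $\mathcal{F}$ is $\bigcup_{F \in \mathcal{F}} F$, and the degree of a vertex is the number of blocks of $\mathcal{F}$ containing it. A $k$-family $\mathcal{F}$ is intersecting if $F \cap G \neq \emptyset$ for all $F, G \in \mathcal{F}$. A set $C$ is a covering set of $\mathcal{F}$ if $C \cap F \neq \emptyset$ for all $F \in \mathcal{F}$. The transversal size of $\mathcal{F}$ is the smallest integer $t$ such that there exists a covering set of $\mathcal{F}$ with exactly $t$ elements. *)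

theory Defs
  imports Complex_Main
begin

definition k_set :: "nat \<Rightarrow> 'a set \<Rightarrow> bool" where
  "k_set k F \<longleftrightarrow> finite F \<and> card F = k"

definition k_family :: "nat \<Rightarrow> 'a set set \<Rightarrow> bool" where
  "k_family k \<F> \<longleftrightarrow> (\<forall>F\<in>\<F>. k_set k F)"

definition vertices :: "'a set set \<Rightarrow> 'a set" where
  "vertices \<F> = \<Union>\<F>"

definition degree :: "'a set set \<Rightarrow> 'a \<Rightarrow> nat" where
  "degree \<F> v = card {F \<in> \<F>. v \<in> F}"

definition intersecting :: "'a set set \<Rightarrow> bool" where
  "intersecting \<F> \<longleftrightarrow> (\<forall>F\<in>\<F>. \<forall>G\<in>\<F>. F \<inter> G \<noteq> {})"

definition covering_set :: "'a set set \<Rightarrow> 'a set \<Rightarrow> bool" where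
  "covering_set \<F> C \<longleftrightarrow> (\<forall>F\<in>\<F>. C \<inter> F \<noteq> {})"

(* Meaningful whenever some finite covering set exists, in particular
   for every finite family of nonempty sets. *)
definition transversal_size :: "'a set set \<Rightarrow> nat" where
  "transversal_size \<F> = (LEAST t. \<exists>C. covering_set \<F> C \<and> finite C \<and> card C = t)"

end

theory Submission
  imports Defs "HOL-Library.Nat_Bijection"
begin

text \<open>The family is the dual of the projective space PG(m,2), whose points are the nonzero
  vectors of \<open>F\<^sub>2\<^sup>m\<^sup>+\<^sup>1\<close>, written as natural numbers below \<open>2^(m+1)\<close> with addition \<open>XOR\<close>, and
  whose lines are the triples \<open>{a, b, a XOR b}\<close>. The lines are the vertices of the family, and the
  block of a point is the set of lines through it. Two points span a line, so blocks intersect; a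
  line has three points, so degrees are 3; and the lines through a point partition the other \<open>2k\<close>
  points into pairs, so blocks have size \<open>k\<close>. Finally, a vertex set \<open>C\<close> meets at
  most \<open>3|C|\<close> blocks.\<close>

text \<open>Isolates what is used of PG(m,2): the facts on the dual family below follow from these
  incidence axioms and the number of points.\<close>

locale steiner_triple_system =
  fixes P :: "'a set" and L :: "'a set set"
  assumes finite_points: "finite P"
    and line_subset: "l \<in> L \<Longrightarrow> l \<subseteq> P"
    and card_line: "l \<in> L \<Longrightarrow> card l = 3"
    and line_ex: "p \<in> P \<Longrightarrow> q \<in> P \<Longrightarrow> p \<noteq> q \<Longrightarrow> \<exists>l\<in>L. p \<in> l \<and> q \<in> l"
    and line_unique: "l \<in> L \<Longrightarrow> l' \<in> L \<Longrightarrow> p \<noteq> q \<Longrightarrow> {p, q} \<subseteq> l \<Longrightarrow> {p, q} \<subseteq> l' \<Longrightarrow> l = l'"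
begin

definition lines_through :: "'a \<Rightarrow> 'a set set" where
  "lines_through p = {l \<in> L. p \<in> l}"

definition dual_family :: "'a set set set" where
  "dual_family = lines_through ` P"

lemma finite_lines: "finite L"
proof (rule finite_subset)
  show "L \<subseteq> Pow P"
    using line_subset by blast
qed (simp add: finite_points)

lemma finite_line: "l \<in> L \<Longrightarrow> finite l"
  using line_subset finite_points finite_subset by blast

lemma finite_lines_through: "finite (lines_through p)"
  using finite_lines by (simp add: lines_through_def)

lemma card_lines_through:
  assumes "p \<in> P"
  shows "2 * card (lines_through p) = card P - 1"
proof -
  have partition: "P - {p} = (\<Union>l\<in>lines_through p. l - {p})"
  proof
    show "P - {p} \<subseteq> (\<Union>l\<in>lines_through p. l - {p})"
      using line_ex[OF assms] unfolding lines_through_def by blast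
    show "(\<Union>l\<in>lines_through p. l - {p}) \<subseteq> P - {p}"
      using line_subset unfolding lines_through_def by blast
  qed
  have "card (\<Union>l\<in>lines_through p. l - {p}) = (\<Sum>l\<in>lines_through p. card (l - {p}))"
  proof (rule card_UN_disjoint)
    show "\<forall>l\<in>lines_through p. finite (l - {p})"
      using finite_line by (simp add: lines_through_def)
    show "\<forall>l\<in>lines_through p. \<forall>l'\<in>lines_through p. l \<noteq> l' \<longrightarrow> (l - {p}) \<inter> (l' - {p}) = {}"
      using line_unique unfolding lines_through_def by blast
  qed (rule finite_lines_through)
  also have "\<dots> = (\<Sum>l\<in>lines_through p. 2)"
    using card_line by (intro sum.cong) (auto simp: lines_through_def)
  finally have "card (P - {p}) = 2 * card (lines_through p)"
    unfolding partition by simp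
  then show ?thesis
    using assms finite_points by simp
qed

text \<open>If \<open>p\<close> and \<open>q\<close> had the same lines, each of them would be the
  line joining \<open>p\<close> and \<open>q\<close>, but more than three points force at least two
  lines through \<open>p\<close>. As \<open>dual_family\<close> is a set, both its size and its
  degrees depend on distinct points giving distinct blocks.\<close>

lemma inj_on_lines_through:
  assumes "card P > 3"
  shows "inj_on lines_through P"
proof (rule inj_onI, rule ccontr)
  fix p q
  assume "p \<in> P" "q \<in> P" and eq: "lines_through p = lines_through q" and "p \<noteq> q"
  have "l = l'" if "l \<in> lines_through p" "l' \<in> lines_through p" for l l'
    using that eq line_unique[of l l' p q] \<open>p \<noteq> q\<close> by (auto simp: lines_through_def)
  then have "card (lines_through p) \<le> Suc 0"
    using finite_lines_through by (simp add: card_le_Suc0_iff_eq)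
  then show False
    using card_lines_through[OF \<open>p \<in> P\<close>] assms by simp
qed

lemma card_dual_family: "card P > 3 \<Longrightarrow> card dual_family = card P"
  by (simp add: dual_family_def card_image inj_on_lines_through)

lemma k_family_dual_family: "k_family ((card P - 1) div 2) dual_family"
proof -
  have "card (lines_through p) = (card P - 1) div 2" if "p \<in> P" for p
    using card_lines_through[OF that] by linarith
  then show ?thesis
    by (auto simp: k_family_def k_set_def dual_family_def finite_lines_through)
qed

lemma intersecting_dual_family:
  assumes "card P > 1"
  shows "intersecting dual_family"
proof -
  have "lines_through p \<inter> lines_through q \<noteq> {}" if "p \<in> P" "q \<in> P" for p q
  proof (cases "p = q")
    case True
    \<comment> \<open>The definition of \<open>intersecting\<close> also covers a block paired with
      itself, so blocks must be nonempty.\<close>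
    have "card (lines_through p) \<noteq> 0"
      using card_lines_through[OF \<open>p \<in> P\<close>] assms by linarith
    then show ?thesis
      using True by auto
  next
    case False
    then show ?thesis
      using line_ex[OF that] by (auto simp: lines_through_def)
  qed
  then show ?thesis
    by (auto simp: intersecting_def dual_family_def)
qed

lemma degree_dual_family:
  assumes "card P > 3" and "l \<in> vertices dual_family"
  shows "degree dual_family l = 3"
proof -
  have "l \<in> L"
    using assms by (auto simp: vertices_def dual_family_def lines_through_def)
  then have "{F \<in> dual_family. l \<in> F} = lines_through ` l"
    using line_subset by (auto simp: dual_family_def lines_through_def)
  moreover have "inj_on lines_through l"
    using inj_on_lines_through assms(1) line_subset[OF \<open>l \<in> L\<close>] inj_on_subset by blast
  ultimately show ?thesis
    using card_line[OF \<open>l \<in> L\<close>] by (simp add: degree_def card_image)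
qed

end

text \<open>Double counting on a smallest covering set: every block contains one of its elements,
  and each element lies in at most \<open>d\<close> blocks.\<close>

lemma degree_mult_transversal_size_ge:
  assumes "finite \<F>" and "\<And>F. F \<in> \<F> \<Longrightarrow> finite F \<and> F \<noteq> {}"
    and deg: "\<And>v. v \<in> vertices \<F> \<Longrightarrow> degree \<F> v \<le> d"
  shows "card \<F> \<le> d * transversal_size \<F>"
proof -
  \<comment> \<open>Some finite covering set must exist for the \<open>LEAST\<close> to be
    attained.\<close>
  have "covering_set \<F> (\<Union>\<F>)" "finite (\<Union>\<F>)"
    using assms by (auto simp: covering_set_def)
  then have "\<exists>t C. covering_set \<F> C \<and> finite C \<and> card C = t"
    by blast
  from LeastI_ex[OF this]
  obtain C where C: "covering_set \<F> C" "finite C" "card C = transversal_size \<F>"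
    by (auto simp: transversal_size_def)
  have "degree \<F> v \<le> d" for v
  \<comment> \<open>A covering set may contain elements outside every block; these have degree
    0.\<close>
  proof (cases "v \<in> vertices \<F>")
    case False
    then have no_block: "{F \<in> \<F>. v \<in> F} = {}"
      by (auto simp: vertices_def)
    show ?thesis
      by (simp only: degree_def no_block card.empty)
  qed (rule deg)
  then have "(\<Sum>v\<in>C. degree \<F> v) \<le> card C * d"
    by (simp add: sum_bounded_above[where K = d, simplified])
  moreover have "\<F> = (\<Union>v\<in>C. {F \<in> \<F>. v \<in> F})"
    using C(1) by (auto simp: covering_set_def)
  then have "card \<F> \<le> (\<Sum>v\<in>C. degree \<F> v)"
    using card_UN_le[OF \<open>finite C\<close>, of "\<lambda>v. {F \<in> \<F>. v \<in> F}"] by (simp add: degree_def)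
  ultimately show ?thesis
    using C(3) by (simp add: mult.commute)
qed

lemma vertices_image: "vertices ((`) f ` \<F>) = f ` vertices \<F>"
  by (auto simp: vertices_def)

text \<open>Blocks lie inside the vertex set, where \<open>f\<close> is injective, so relabelling
  vertices merges no blocks.\<close>

lemma inj_on_image_family: "inj_on f (vertices \<F>) \<Longrightarrow> inj_on ((`) f) \<F>"
  by (rule inj_onI) (metis Union_upper inj_on_image_eq_iff vertices_def)

lemma card_image_family: "inj_on f (vertices \<F>) \<Longrightarrow> card ((`) f ` \<F>) = card \<F>"
  by (rule card_image) (rule inj_on_image_family)

lemma k_family_image:
  assumes "inj_on f (vertices \<F>)" and "k_family k \<F>"
  shows "k_family k ((`) f ` \<F>)"
  using assms inj_on_subset[OF assms(1)]
  by (auto simp: k_family_def k_set_def vertices_def Union_upper card_image)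

lemma intersecting_image: "intersecting \<F> \<Longrightarrow> intersecting ((`) f ` \<F>)"
  by (fastforce simp: intersecting_def)

lemma degree_image:
  assumes inj: "inj_on f (vertices \<F>)" and "v \<in> vertices \<F>"
  shows "degree ((`) f ` \<F>) (f v) = degree \<F> v"
proof -
  have "f v \<in> f ` F \<longleftrightarrow> v \<in> F" if "F \<in> \<F>" for F
    using inj_on_image_mem_iff[OF inj assms(2)] that by (auto simp: vertices_def)
  then have "{G \<in> (`) f ` \<F>. f v \<in> G} = (`) f ` {F \<in> \<F>. v \<in> F}"
    by auto
  moreover have "inj_on ((`) f) {F \<in> \<F>. v \<in> F}"
    using inj_on_image_family[OF inj] by (rule inj_on_subset) auto
  ultimately show ?thesis
    by (simp add: degree_def card_image)
qed

unbundle bit_operations_syntax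

lemma xor_less_power2:
  fixes a b :: nat
  assumes "a < 2 ^ n" "b < 2 ^ n"
  shows "a XOR b < 2 ^ n"
  using assms by (metis take_bit_nat_eq_self_iff take_bit_xor)

lemma xor_left_cancel_nat: "a XOR (a XOR b) = b" for a b :: nat
  by (simp flip: xor.assoc)

lemma xor_eq_0_iff_nat: "a XOR b = 0 \<longleftrightarrow> a = b" for a b :: nat
  using xor_left_cancel_nat[of a b] by auto

lemma xor_right_cancel_nat: "(a XOR b) XOR b = a" for a b :: nat
  by (simp add: xor.assoc)

text \<open>Over the field with two elements the only nonzero scalar is 1, so each nonzero vector is
  a projective point. Here \<open>n\<close> is the vector space dimension, one more than the
  projective one.\<close>

definition pg2_points :: "nat \<Rightarrow> nat set" where
  "pg2_points n = {0<..<2 ^ n}"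

definition pg2_lines :: "nat \<Rightarrow> nat set set" where
  "pg2_lines n = {{a, b, a XOR b} | a b. a \<in> pg2_points n \<and> b \<in> pg2_points n \<and> a \<noteq> b}"

text \<open>The sum of any two points of a line is the third, so two points recover the
  line.\<close>

lemma pg2_line_determined:
  assumes "l \<in> pg2_lines n" "p \<noteq> q" "{p, q} \<subseteq> l"
  shows "l = {p, q, p XOR q}"
proof -
  obtain a b where l: "l = {a, b, a XOR b}"
    using assms(1) by (auto simp: pg2_lines_def)
  \<comment> \<open>The pair \<open>p\<close>, \<open>q\<close> can be any of six ordered pairs;
    these are the cases beyond the cancellation rules and \<open>a XOR b\<close> itself.\<close>
  have "b XOR a = a XOR b" "b XOR (a XOR b) = a" "(a XOR b) XOR a = b"
    using xor_left_cancel_nat[of b a] xor_left_cancel_nat[of a b]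
    by (simp_all add: xor.commute)
  then show ?thesis
    using assms(2,3) unfolding l by (auto simp: xor_left_cancel_nat xor_right_cancel_nat)
qed

lemma steiner_triple_system_pg2: "steiner_triple_system (pg2_points n) (pg2_lines n)"
proof
  show "finite (pg2_points n)"
    by (simp add: pg2_points_def)
next
  fix l
  assume "l \<in> pg2_lines n"
  then obtain a b where l: "l = {a, b, a XOR b}"
    and ab: "a \<in> pg2_points n" "b \<in> pg2_points n" "a \<noteq> b"
    by (auto simp: pg2_lines_def)
  then have "a XOR b \<in> pg2_points n"
    using xor_less_power2[of a n b] xor_eq_0_iff_nat[of a b] by (simp add: pg2_points_def)
  then show "l \<subseteq> pg2_points n"
    using l ab by simp
  \<comment> \<open>Equality would make \<open>b\<close> or \<open>a\<close> zero, and zero is not a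
    point.\<close>
  have "a XOR b \<noteq> a" "a XOR b \<noteq> b"
    using ab xor_left_cancel_nat[of a b] xor_right_cancel_nat[of a b]
    by (auto simp: pg2_points_def)
  then show "card l = 3"
    using l ab(3) by auto
next
  fix p q
  assume "p \<in> pg2_points n" "q \<in> pg2_points n" "p \<noteq> q"
  then have "{p, q, p XOR q} \<in> pg2_lines n"
    by (auto simp: pg2_lines_def)
  then show "\<exists>l\<in>pg2_lines n. p \<in> l \<and> q \<in> l"
    by blast
next
  fix l l' p q
  assume "l \<in> pg2_lines n" "l' \<in> pg2_lines n" "p \<noteq> q" "{p, q} \<subseteq> l" "{p, q} \<subseteq> l'"
  then show "l = l'"
    using pg2_line_determined by metis
qed

theorem theorem2p4:
  fixes m k :: nat
  assumes "m \<ge> 2"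
    and "k = 2 ^ m - 1"
  shows "\<exists>\<F> :: nat set set.
           k_family k \<F> \<and>
           intersecting \<F> \<and>
           (\<forall>v\<in>vertices \<F>. degree \<F> v = 3) \<and>
           card \<F> = 2 * k + 1 \<and>
           real (transversal_size \<F>) \<ge> (2 * real k + 1) / 3"
proof -
  interpret steiner_triple_system "pg2_points (Suc m)" "pg2_lines (Suc m)"
    by (rule steiner_triple_system_pg2)
  \<comment> \<open>Gives \<open>k \<ge> 3\<close>, hence at least seven points, enough for
    \<open>inj_on_lines_through\<close>.\<close>
  have "(2::nat) ^ 2 \<le> 2 ^ m"
    using assms(1) by (intro power_increasing) auto
  then have cardP: "card (pg2_points (Suc m)) = 2 * k + 1" and "k \<ge> 3"
    using assms(2) by (auto simp: pg2_points_def)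
  \<comment> \<open>The vertices so far are lines, that is, sets of naturals.
    \<open>set_encode\<close> turns them into naturals, but is injective only on finite
    sets.\<close>
  have "vertices dual_family \<subseteq> Collect finite"
    using finite_line by (auto simp: vertices_def dual_family_def lines_through_def)
  then have inj: "inj_on set_encode (vertices dual_family)"
    using inj_on_set_encode inj_on_subset by blast
  define \<F> where "\<F> = (`) set_encode ` dual_family"
  have fam: "k_family k \<F>"
    using k_family_image[OF inj k_family_dual_family] cardP by (simp add: \<F>_def)
  have int: "intersecting \<F>"
    using intersecting_image intersecting_dual_family cardP \<open>k \<ge> 3\<close> by (simp add: \<F>_def)
  have deg: "\<forall>v\<in>vertices \<F>. degree \<F> v = 3"
    using degree_image[OF inj] degree_dual_family cardP \<open>k \<ge> 3\<close>
    by (auto simp: \<F>_def vertices_image)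
  have card: "card \<F> = 2 * k + 1"
    using card_image_family[OF inj] card_dual_family cardP \<open>k \<ge> 3\<close> by (simp add: \<F>_def)
  have "card \<F> \<le> 3 * transversal_size \<F>"
  proof (rule degree_mult_transversal_size_ge)
    show "finite \<F>"
      \<comment> \<open>An infinite set has \<open>card\<close> 0, which differs from
        \<open>2 * k + 1\<close>.\<close>
      using card card.infinite by fastforce
    show "finite F \<and> F \<noteq> {}" if "F \<in> \<F>" for F
      using that fam int by (auto simp: k_family_def k_set_def intersecting_def)
    show "degree \<F> v \<le> 3" if "v \<in> vertices \<F>" for v
      using that deg by simp
  qed
  then have "2 * real k + 1 \<le> 3 * real (transversal_size \<F>)"
    using card by linarith
  then have "real (transversal_size \<F>) \<ge> (2 * real k + 1) / 3"
    by simp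
  then show ?thesis
    using fam int deg card by blast
qed

end
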